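(* Let $X=\ell^2(\mathbb{N})$ be the real Hilbert space of square-summable sequences $x=(x_n)_{n\ge 1}$, and let $f$ be defined on $X$ by $$(f(x))_n = 3\,\sqrt[n]{|x_n|}\;x_n,\qquad n\in\mathbb{N}=\{1,2,3,\dots\}.$$ Consider the non-linear system on $X$ $$\dot{x}(t)=-x(t)+f(x(t)),\qquad x(0)=x_0 .$$ Then the following hold. 1. $f$ is a (locally) Lipschitz continuous map from $X$ to $X$. 2. $f$ is Gateaux differentiable at the origin, but not Fréchet differentiable at the origin. 3. The origin is an unstable equilibrium point of the system.
   Context: (Locally) Lipschitz continuous from $X$ to $X$ means that for every $r>0$ there is a constant $L_r$ with $\|f(x)-f(z)\|\le L_r\|x-z\|$ for all $x,z\in X$ with $\|x\|,\|z\|\le r$. $f$ is Gateaux differentiable at $0$ if there is a bounded linear operator $D\in\mathcal{L}(X)$ such that for every $x\in X$, $\lim_{\varepsilon\to0}\left\|\frac{f(\varepsilon x)-f(0)}{\varepsilon}-Dx\right\|=0$ ($\varepsilon\in\mathbb{R}\setminus\{0\}$). The origin is an unstable equilibrium point if it is an equilibrium that is not stable in the sense of Lyapunov, where stability means: for every $\eta>0$ there is $\delta>0$ such that every solution with $\|x(0)\|<\delta$ exists for all $t\ge 0$ and satisfies $\|x(t)\|<\eta$ for all $t\ge0$. *)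

theory Defs
  imports "HOL-Analysis.Analysis"
begin

section \<open>The real Hilbert space of square-summable sequences\<close>

text \<open>Sequences are indexed from 0, so \<open>coord x k\<close> is the entry usually written
  \<open>x\<^sub>n\<close> with \<open>n = k + 1 \<ge> 1\<close>.\<close>

definition square_summable :: "(nat \<Rightarrow> real) set"
  where "square_summable = {u. summable (\<lambda>k. (u k)\<^sup>2)}"

lemma square_summable_iff: "u \<in> square_summable \<longleftrightarrow> summable (\<lambda>k. (u k)\<^sup>2)"
  by (simp add: square_summable_def)

lemma square_summable_zero: "(\<lambda>k. 0) \<in> square_summable"
  by (simp add: square_summable_iff)

lemma square_summable_mult:
  assumes "u \<in> square_summable" "v \<in> square_summable"
  shows "summable (\<lambda>k. u k * v k)"
proof (rule summable_comparison_test)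
  show "summable (\<lambda>k. (u k)\<^sup>2 + (v k)\<^sup>2)"
    using assms by (simp add: square_summable_iff summable_add)
  have "\<bar>a * b\<bar> \<le> a\<^sup>2 + b\<^sup>2" for a b :: real
  proof -
    have "2 * (\<bar>a\<bar> * \<bar>b\<bar>) \<le> a\<^sup>2 + b\<^sup>2"
      using sum_squares_bound[of "\<bar>a\<bar>" "\<bar>b\<bar>"] by (simp add: mult.assoc)
    moreover have "0 \<le> \<bar>a\<bar> * \<bar>b\<bar>" by simp
    ultimately show ?thesis by (simp only: abs_mult)
  qed
  then show "\<exists>N. \<forall>k\<ge>N. norm (u k * v k) \<le> (u k)\<^sup>2 + (v k)\<^sup>2"
    by simp
qed

lemma square_summable_scale: "u \<in> square_summable \<Longrightarrow> (\<lambda>k. c * u k) \<in> square_summable"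
  by (simp add: square_summable_iff power_mult_distrib summable_mult)

lemma square_summable_add:
  assumes "u \<in> square_summable" "v \<in> square_summable"
  shows "(\<lambda>k. u k + v k) \<in> square_summable"
proof -
  have "summable (\<lambda>k. (u k)\<^sup>2 + (v k)\<^sup>2 + 2 * (u k * v k))"
    using assms square_summable_mult[OF assms]
    by (intro summable_add summable_mult) (simp_all add: square_summable_iff)
  then show ?thesis
    by (simp add: square_summable_iff power2_sum mult.assoc)
qed

lemma square_summable_uminus: "u \<in> square_summable \<Longrightarrow> (\<lambda>k. - u k) \<in> square_summable"
  by (simp add: square_summable_iff)

lemma square_summable_diff:
  "u \<in> square_summable \<Longrightarrow> v \<in> square_summable \<Longrightarrow> (\<lambda>k. u k - v k) \<in> square_summable"
  using square_summable_add[of u "\<lambda>k. - v k"] square_summable_uminus[of v] by simp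

typedef ell2 = square_summable
  morphisms coord of_seq
  using square_summable_zero by blast

setup_lifting type_definition_ell2

lemma ell2_eqI: "(\<And>k. coord x k = coord y k) \<Longrightarrow> x = y"
  by (metis coord_inject ext)

lemma summable_coord_mult: "summable (\<lambda>k. coord x k * coord y k)"
  by (intro square_summable_mult coord)

lemma summable_coord_square: "summable (\<lambda>k. (coord x k)\<^sup>2)"
  using coord[of x] by (simp add: square_summable_iff)

instantiation ell2 :: real_vector
begin

lift_definition zero_ell2 :: ell2 is "\<lambda>k. 0"
  by (rule square_summable_zero)

lift_definition plus_ell2 :: "ell2 \<Rightarrow> ell2 \<Rightarrow> ell2" is "\<lambda>u v k. u k + v k"
  by (rule square_summable_add)

lift_definition minus_ell2 :: "ell2 \<Rightarrow> ell2 \<Rightarrow> ell2" is "\<lambda>u v k. u k - v k"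
  by (rule square_summable_diff)

lift_definition uminus_ell2 :: "ell2 \<Rightarrow> ell2" is "\<lambda>u k. - u k"
  by (rule square_summable_uminus)

lift_definition scaleR_ell2 :: "real \<Rightarrow> ell2 \<Rightarrow> ell2" is "\<lambda>c u k. c * u k"
  by (rule square_summable_scale)

instance
  by standard (transfer; simp add: fun_eq_iff algebra_simps)+

end

lemma coord_zero [simp]: "coord 0 k = 0"
  and coord_add [simp]: "coord (x + y) k = coord x k + coord y k"
  and coord_diff [simp]: "coord (x - y) k = coord x k - coord y k"
  and coord_uminus [simp]: "coord (- x) k = - coord x k"
  and coord_scaleR [simp]: "coord (c *\<^sub>R x) k = c * coord x k"
  by (transfer; simp)+

instantiation ell2 :: real_inner
begin

definition inner_ell2 :: "ell2 \<Rightarrow> ell2 \<Rightarrow> real"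
  where "inner_ell2 x y = (\<Sum>k. coord x k * coord y k)"

definition norm_ell2 :: "ell2 \<Rightarrow> real"
  where "norm_ell2 x = sqrt (inner x x)"

definition sgn_ell2 :: "ell2 \<Rightarrow> ell2"
  where "sgn_ell2 x = x /\<^sub>R norm x"

definition dist_ell2 :: "ell2 \<Rightarrow> ell2 \<Rightarrow> real"
  where "dist_ell2 x y = norm (x - y)"

definition uniformity_ell2 :: "(ell2 \<times> ell2) filter"
  where "uniformity_ell2 = (INF e\<in>{0<..}. principal {(x, y). dist x y < e})"

definition open_ell2 :: "ell2 set \<Rightarrow> bool"
  where "open_ell2 U = (\<forall>x\<in>U. eventually (\<lambda>(x', y). x' = x \<longrightarrow> y \<in> U) uniformity)"

instance
proof
  fix x y z :: ell2 and c :: real and U :: "ell2 set"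
  show "dist x y = norm (x - y)" by (rule dist_ell2_def)
  show "sgn x = x /\<^sub>R norm x" by (rule sgn_ell2_def)
  show "uniformity = (INF e\<in>{0<..}. principal {(x::ell2, y). dist x y < e})"
    by (rule uniformity_ell2_def)
  show "open U = (\<forall>x\<in>U. eventually (\<lambda>(x', y). x' = x \<longrightarrow> y \<in> U) uniformity)"
    by (rule open_ell2_def)
  show "inner x y = inner y x"
    by (simp add: inner_ell2_def mult.commute)
  show "inner (x + y) z = inner x z + inner y z"
    by (simp add: inner_ell2_def distrib_right suminf_add summable_coord_mult)
  show "inner (c *\<^sub>R x) y = c * inner x y"
    by (simp add: inner_ell2_def mult.assoc suminf_mult summable_coord_mult)
  show "0 \<le> inner x x"
    by (simp add: inner_ell2_def suminf_nonneg summable_coord_mult)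
  show "inner x x = 0 \<longleftrightarrow> x = 0"
  proof
    assume "inner x x = 0"
    then have "\<forall>k. coord x k * coord x k = 0"
      using suminf_eq_zero_iff[OF summable_coord_mult[of x x]] by (simp add: inner_ell2_def)
    then show "x = 0" by (intro ell2_eqI) simp
  qed (simp add: inner_ell2_def)
  show "norm x = sqrt (inner x x)" by (rule norm_ell2_def)
qed

end

lemma norm_ell2_sq: "(norm (x::ell2))\<^sup>2 = (\<Sum>k. (coord x k)\<^sup>2)"
  unfolding power2_norm_eq_inner inner_ell2_def by (simp add: power2_eq_square)

lemma sum_coord_le_norm: "(\<Sum>k<m. (coord x k)\<^sup>2) \<le> (norm x)\<^sup>2"
  unfolding norm_ell2_sq by (intro sum_le_suminf summable_coord_square) auto

lemma abs_coord_le_norm: "\<bar>coord x k\<bar> \<le> norm x"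
proof -
  have "(coord x k)\<^sup>2 \<le> (\<Sum>j<Suc k. (coord x j)\<^sup>2)"
    by (rule member_le_sum) auto
  also have "\<dots> \<le> (norm x)\<^sup>2" by (rule sum_coord_le_norm)
  finally show ?thesis using abs_le_square_iff[of "coord x k" "norm x"] by simp
qed

instance ell2 :: complete_space
proof
  fix X :: "nat \<Rightarrow> ell2"
  assume X: "Cauchy X"
  have "Cauchy (\<lambda>i. coord (X i) k)" for k
  proof (rule metric_CauchyI)
    fix e :: real assume "0 < e"
    then obtain M where "\<forall>m\<ge>M. \<forall>n\<ge>M. dist (X m) (X n) < e"
      using metric_CauchyD[OF X] by blast
    moreover have "dist (coord (X m) k) (coord (X n) k) \<le> dist (X m) (X n)" for m n
      using abs_coord_le_norm[of "X m - X n" k] by (simp add: dist_norm)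
    ultimately show "\<exists>M. \<forall>m\<ge>M. \<forall>n\<ge>M. dist (coord (X m) k) (coord (X n) k) < e"
      by (meson le_less_trans)
  qed
  then have "\<forall>k. \<exists>l. (\<lambda>i. coord (X i) k) \<longlonglongrightarrow> l"
    by (simp add: Cauchy_convergent_iff convergent_def)
  then obtain l where l: "\<And>k. (\<lambda>i. coord (X i) k) \<longlonglongrightarrow> l k"
    by metis
  have bound: "\<exists>M. \<forall>n\<ge>M. \<forall>m. (\<Sum>k<m. (coord (X n) k - l k)\<^sup>2) \<le> e\<^sup>2" if e: "0 < e" for e :: real
  proof -
    obtain M where M: "\<And>i n. i \<ge> M \<Longrightarrow> n \<ge> M \<Longrightarrow> dist (X i) (X n) < e"
      using metric_CauchyD[OF X e] by blast
    have "(\<Sum>k<m. (coord (X n) k - l k)\<^sup>2) \<le> e\<^sup>2" if n: "n \<ge> M" for n m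
    proof (rule LIMSEQ_le_const2)
      show "(\<lambda>i. \<Sum>k<m. (coord (X n) k - coord (X i) k)\<^sup>2) \<longlonglongrightarrow> (\<Sum>k<m. (coord (X n) k - l k)\<^sup>2)"
        by (intro tendsto_intros l)
      have "(\<Sum>k<m. (coord (X n) k - coord (X i) k)\<^sup>2) \<le> e\<^sup>2" if "i \<ge> M" for i
      proof -
        have "(\<Sum>k<m. (coord (X n) k - coord (X i) k)\<^sup>2) \<le> (norm (X n - X i))\<^sup>2"
          using sum_coord_le_norm[of "X n - X i" m] by simp
        also have "\<dots> \<le> e\<^sup>2"
          using M[OF n that] by (intro power_mono) (auto simp: dist_norm)
        finally show ?thesis .
      qed
      then show "\<exists>N. \<forall>i\<ge>N. (\<Sum>k<m. (coord (X n) k - coord (X i) k)\<^sup>2) \<le> e\<^sup>2"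
        by blast
    qed
    then show ?thesis by blast
  qed
  have diff: "(\<lambda>k. coord (X n) k - l k) \<in> square_summable"
    if "\<forall>m. (\<Sum>k<m. (coord (X n) k - l k)\<^sup>2) \<le> e\<^sup>2" for n and e :: real
    unfolding square_summable_iff
    using that by (intro summableI_nonneg_bounded[where x = "e\<^sup>2"]) auto
  obtain M1 where "\<forall>m. (\<Sum>k<m. (coord (X M1) k - l k)\<^sup>2) \<le> 1\<^sup>2"
    using bound[of 1] by auto
  then have "(\<lambda>k. coord (X M1) k - (coord (X M1) k - l k)) \<in> square_summable"
    by (intro square_summable_diff diff coord)
  then have l_mem: "l \<in> square_summable" by simp
  have "X \<longlonglongrightarrow> of_seq l"
  proof (rule metric_LIMSEQ_I)
    fix e :: real assume e: "0 < e"
    then obtain M where M: "\<And>n m. n \<ge> M \<Longrightarrow> (\<Sum>k<m. (coord (X n) k - l k)\<^sup>2) \<le> (e / 2)\<^sup>2"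
      using bound[of "e / 2"] by auto
    have "dist (X n) (of_seq l) < e" if "n \<ge> M" for n
    proof -
      have "(norm (X n - of_seq l))\<^sup>2 = (\<Sum>k. (coord (X n) k - l k)\<^sup>2)"
        by (simp add: norm_ell2_sq of_seq_inverse[OF l_mem])
      also have "\<dots> \<le> (e / 2)\<^sup>2"
        using M[OF that] diff[of n "e / 2"]
        by (intro suminf_le_const) (auto simp: square_summable_iff)
      finally have "norm (X n - of_seq l) \<le> e / 2"
        by (rule power2_le_imp_le) (use e in simp)
      then show ?thesis using e by (simp add: dist_norm)
    qed
    then show "\<exists>no. \<forall>n\<ge>no. dist (X n) (of_seq l) < e" by blast
  qed
  then show "convergent X" by (rule convergentI)
qed

section \<open>Regularity and stability notions\<close>

definition locally_lipschitz :: "('a::real_normed_vector \<Rightarrow> 'a) \<Rightarrow> bool"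
  where "locally_lipschitz g \<longleftrightarrow>
    (\<forall>r>0. \<exists>L. \<forall>x z. norm x \<le> r \<longrightarrow> norm z \<le> r \<longrightarrow> norm (g x - g z) \<le> L * norm (x - z))"

definition gateaux_differentiable_at_0 :: "('a::real_normed_vector \<Rightarrow> 'a) \<Rightarrow> bool"
  where "gateaux_differentiable_at_0 g \<longleftrightarrow>
    (\<exists>D. bounded_linear D \<and>
      (\<forall>x. ((\<lambda>\<epsilon>::real. norm ((g (\<epsilon> *\<^sub>R x) - g 0) /\<^sub>R \<epsilon> - D x)) \<longlongrightarrow> 0) (at 0)))"

text \<open>A solution of \<open>x' = g x\<close> is a pair of a time interval \<open>J\<close> starting at 0 (with more than
  one point) and a function \<open>x\<close>, of which only the values on \<open>J\<close> matter. At the endpoints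
  contained in \<open>J\<close> the derivative is one-sided.\<close>

definition solution_on :: "('a::real_normed_vector \<Rightarrow> 'a) \<Rightarrow> real set \<Rightarrow> (real \<Rightarrow> 'a) \<Rightarrow> bool"
  where "solution_on g J x \<longleftrightarrow>
    is_interval J \<and> 0 \<in> J \<and> J \<subseteq> {0..} \<and> J \<noteq> {0} \<and>
    (\<forall>t\<in>J. (x has_vector_derivative g (x t)) (at t within J))"

definition maximal_solution_on :: "('a::real_normed_vector \<Rightarrow> 'a) \<Rightarrow> real set \<Rightarrow> (real \<Rightarrow> 'a) \<Rightarrow> bool"
  where "maximal_solution_on g J x \<longleftrightarrow>
    solution_on g J x \<and>
    (\<forall>J' y. solution_on g J' y \<longrightarrow> J \<subseteq> J' \<longrightarrow> (\<forall>t\<in>J. y t = x t) \<longrightarrow> J' = J)"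

text \<open>That every solution starting near 0 \<open>exists for all t \<ge> 0\<close> means that its maximal interval
  of existence is \<open>{0..}\<close>.\<close>

definition lyapunov_stable_at_0 :: "('a::real_normed_vector \<Rightarrow> 'a) \<Rightarrow> bool"
  where "lyapunov_stable_at_0 g \<longleftrightarrow>
    (\<forall>\<eta>>0. \<exists>\<delta>>0. \<forall>J x. maximal_solution_on g J x \<longrightarrow> norm (x 0) < \<delta> \<longrightarrow>
      J = {0..} \<and> (\<forall>t\<ge>0. norm (x t) < \<eta>))"

definition unstable_equilibrium_at_0 :: "('a::real_normed_vector \<Rightarrow> 'a) \<Rightarrow> bool"
  where "unstable_equilibrium_at_0 g \<longleftrightarrow> g 0 = 0 \<and> \<not> lyapunov_stable_at_0 g"

section \<open>The nonlinearity\<close>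

definition f_seq :: "(nat \<Rightarrow> real) \<Rightarrow> nat \<Rightarrow> real"
  where "f_seq u k = 3 * root (Suc k) \<bar>u k\<bar> * u k"

text \<open>The coordinates of \<open>f_ell2 x\<close> are \<open>f_seq (coord x)\<close> only if the latter is square-summable;
  this has to be shown separately.\<close>

definition f_ell2 :: "ell2 \<Rightarrow> ell2"
  where "f_ell2 x = of_seq (f_seq (coord x))"

end

theory Submission
  imports Defs
begin

text \<open>The map acts coordinatewise, by \<open>s \<mapsto> 3 \<bar>s\<bar>\<^bsup>1/n\<^esup> s\<close>, and these scalar maps are Lipschitz on
  \<open>[-r, r]\<close> with a constant independent of \<open>n\<close>. Each of them has derivative 0 at 0, so the Gateaux
  derivative vanishes by dominated convergence; since \<open>h\<^bsup>1/n\<^esup> \<rightarrow> 1\<close> as \<open>n \<rightarrow> \<infinity>\<close>, the convergence is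
  not uniform over the unit vectors, which rules out a Frechet derivative. On the \<open>n\<close>-th axis the
  system is a Bernoulli equation; its solution starting at \<open>2\<^bsup>-n\<^esup>\<close> is explicit and blows up in
  finite time, although \<open>2\<^bsup>-n\<^esup> \<rightarrow> 0\<close>.\<close>

section \<open>Scalar estimates uniform in the degree of the root\<close>

lemma root_abs_le_max_1:
  assumes "n > 0"
  shows "root n \<bar>s\<bar> \<le> max 1 \<bar>s\<bar>"
proof -
  have "\<bar>s\<bar> \<le> max 1 \<bar>s\<bar> ^ 1" by simp
  also have "\<dots> \<le> max 1 \<bar>s\<bar> ^ n"
    using assms by (intro power_increasing) auto
  finally have "root n \<bar>s\<bar> \<le> root n (max 1 \<bar>s\<bar> ^ n)"
    using assms by simp
  then show ?thesis
    using assms by (simp add: real_root_power_cancel)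
qed

text \<open>By symmetry |b| \<le> |a|, so the roots satisfy \<open>B \<le> A\<close>. In A a - B b =
  A (a - b) + (A - B) b the second term is at most B |a - b| in absolute value. The resulting factor
  A + B is at most \<open>2 * max 1 r\<close>, whatever n is.\<close>

lemma root_abs_mult_lipschitz:
  assumes n: "n > 0" and a: "\<bar>a\<bar> \<le> r" and b: "\<bar>b\<bar> \<le> r"
  shows "\<bar>root n \<bar>a\<bar> * a - root n \<bar>b\<bar> * b\<bar> \<le> 2 * max 1 r * \<bar>a - b\<bar>"
  using a b
proof (induction "\<bar>b\<bar>" "\<bar>a\<bar>" arbitrary: a b rule: linorder_wlog)
  case sym
  then show ?case by (metis abs_minus_commute)
next
  case (le a b)
  define A where "A = root n \<bar>a\<bar>"
  define B where "B = root n \<bar>b\<bar>"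
  have A: "A ^ n = \<bar>a\<bar>" and B: "B ^ n = \<bar>b\<bar>"
    using n by (simp_all add: A_def B_def)
  have B0: "0 \<le> B" and BA: "B \<le> A"
    using n le by (simp_all add: A_def B_def)
  have Ar: "A \<le> max 1 r"
    using root_abs_le_max_1[OF n, of a] le unfolding A_def by linarith
  have pow: "x ^ n = x * x ^ (n - 1)" for x :: real
    using n by (simp add: power_eq_if)
  \<comment> \<open>This gives (A - B) B^(n-1) \<le> A^n - B^n = |a| - |b|; a further factor B then
    turns B^(n-1) into |b|.\<close>
  have "A * B ^ (n - 1) \<le> A ^ n"
    unfolding pow using B0 BA by (intro mult_left_mono power_mono) auto
  then have "(A - B) * B ^ (n - 1) \<le> \<bar>a - b\<bar>"
    using A B pow[of B] by (simp add: left_diff_distrib)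
  then have "B * ((A - B) * B ^ (n - 1)) \<le> B * \<bar>a - b\<bar>"
    using B0 by (rule mult_left_mono)
  then have *: "(A - B) * \<bar>b\<bar> \<le> B * \<bar>a - b\<bar>"
    using pow[of B] B by (simp add: algebra_simps)
  have "A * a - B * b = A * (a - b) + (A - B) * b"
    by (simp add: algebra_simps)
  also have "\<bar>\<dots>\<bar> \<le> A * \<bar>a - b\<bar> + (A - B) * \<bar>b\<bar>"
    using B0 BA by (intro order_trans[OF abs_triangle_ineq]) (simp add: abs_mult)
  also have "\<dots> \<le> (A + B) * \<bar>a - b\<bar>"
    using * by (simp add: algebra_simps)
  also have "\<dots> \<le> 2 * max 1 r * \<bar>a - b\<bar>"
    using Ar BA by (intro mult_right_mono) linarith+
  finally show ?case by (simp add: A_def B_def)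
qed

lemma abs_f_seq_le:
  assumes "\<bar>u k\<bar> \<le> r"
  shows "\<bar>f_seq u k\<bar> \<le> 3 * max 1 r * \<bar>u k\<bar>"
proof -
  have "root (Suc k) \<bar>u k\<bar> \<le> max 1 r"
    using root_abs_le_max_1[of "Suc k" "u k"] assms by linarith
  then show ?thesis
    by (simp add: f_seq_def abs_mult mult_right_mono)
qed

section \<open>Square-summability and local Lipschitz continuity\<close>

lemma f_seq_coord_square_summable: "f_seq (coord x) \<in> square_summable"
  unfolding square_summable_iff
proof (rule summable_comparison_test)
  show "summable (\<lambda>k. (3 * max 1 (norm x))\<^sup>2 * (coord x k)\<^sup>2)"
    by (intro summable_mult summable_coord_square)
  have "(f_seq (coord x) k)\<^sup>2 \<le> (3 * max 1 (norm x) * coord x k)\<^sup>2" for k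
    using abs_f_seq_le[of "coord x" k, OF abs_coord_le_norm]
    by (simp add: abs_le_square_iff[symmetric] abs_mult)
  then show "\<exists>N. \<forall>k\<ge>N. norm ((f_seq (coord x) k)\<^sup>2) \<le> (3 * max 1 (norm x))\<^sup>2 * (coord x k)\<^sup>2"
    by (simp add: power_mult_distrib)
qed

lemma coord_f_ell2: "coord (f_ell2 x) k = 3 * root (Suc k) \<bar>coord x k\<bar> * coord x k"
  by (simp add: f_ell2_def of_seq_inverse f_seq_coord_square_summable f_seq_def)

lemma f_ell2_zero [simp]: "f_ell2 0 = 0"
  by (rule ell2_eqI) (simp add: coord_f_ell2)

lemma norm_ell2_le_mult:
  assumes "0 \<le> c" and le: "\<And>k. \<bar>coord x k\<bar> \<le> c * \<bar>coord y k\<bar>"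
  shows "norm x \<le> c * norm y"
proof (rule power2_le_imp_le)
  have sq: "(coord x k)\<^sup>2 \<le> c\<^sup>2 * (coord y k)\<^sup>2" for k
    using power_mono[OF le[of k], of 2] by (simp add: power_mult_distrib)
  have "(\<Sum>k. (coord x k)\<^sup>2) \<le> (\<Sum>k. c\<^sup>2 * (coord y k)\<^sup>2)"
    by (intro suminf_le sq summable_mult summable_coord_square)
  then show "(norm x)\<^sup>2 \<le> (c * norm y)\<^sup>2"
    by (simp add: norm_ell2_sq power_mult_distrib suminf_mult summable_coord_square)
qed (use assms in simp)

lemma locally_lipschitz_f_ell2: "locally_lipschitz f_ell2"
  unfolding locally_lipschitz_def
proof (intro allI impI exI)
  fix r :: real and x z :: ell2
  assume x: "norm x \<le> r" and z: "norm z \<le> r"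
  \<comment> \<open>The 6 is the factor 3 in \<open>f_seq\<close> times the 2 of the scalar
    estimate, which applies to every coordinate with the same r.\<close>
  show "norm (f_ell2 x - f_ell2 z) \<le> 6 * max 1 r * norm (x - z)"
  proof (rule norm_ell2_le_mult)
    fix k
    have "\<bar>root (Suc k) \<bar>coord x k\<bar> * coord x k - root (Suc k) \<bar>coord z k\<bar> * coord z k\<bar>
        \<le> 2 * max 1 r * \<bar>coord x k - coord z k\<bar>"
      using x z abs_coord_le_norm[of x k] abs_coord_le_norm[of z k]
      by (intro root_abs_mult_lipschitz) linarith+
    moreover have "coord (f_ell2 x - f_ell2 z) k =
        3 * (root (Suc k) \<bar>coord x k\<bar> * coord x k - root (Suc k) \<bar>coord z k\<bar> * coord z k)"
      by (simp add: coord_f_ell2 right_diff_distrib)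
    ultimately show "\<bar>coord (f_ell2 x - f_ell2 z) k\<bar> \<le> 6 * max 1 r * \<bar>coord (x - z) k\<bar>"
      by (simp only: abs_mult coord_diff) simp
  qed simp
qed

section \<open>Gateaux differentiability at the origin\<close>

lemma gateaux_differentiable_f_ell2: "gateaux_differentiable_at_0 f_ell2"
  unfolding gateaux_differentiable_at_0_def
proof (intro exI conjI allI)
  show "bounded_linear (\<lambda>x::ell2. 0 :: ell2)"
    by (rule bounded_linear_zero)
  fix x :: ell2
  define q where "q \<epsilon> = f_ell2 (\<epsilon> *\<^sub>R x) /\<^sub>R \<epsilon>" for \<epsilon> :: real
  define M where "M = 3 * max 1 (norm x)"
  have q: "coord (q \<epsilon>) k = 3 * root (Suc k) \<bar>\<epsilon> * coord x k\<bar> * coord x k"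
    if "\<epsilon> \<noteq> 0" for \<epsilon> k
    using that by (simp add: q_def coord_f_ell2)
  have lim: "((\<lambda>\<epsilon>. (coord (q \<epsilon>) k)\<^sup>2) \<longlongrightarrow> 0) (at 0)" for k
  proof -
    have "((\<lambda>\<epsilon>. (3 * root (Suc k) \<bar>\<epsilon> * coord x k\<bar> * coord x k)\<^sup>2)
        \<longlongrightarrow> (3 * root (Suc k) \<bar>0 * coord x k\<bar> * coord x k)\<^sup>2) (at 0)"
      by (intro tendsto_intros)
    then have "((\<lambda>\<epsilon>. (3 * root (Suc k) \<bar>\<epsilon> * coord x k\<bar> * coord x k)\<^sup>2) \<longlongrightarrow> 0) (at 0)"
      by simp
    then show ?thesis
      by (rule Lim_transform_eventually) (auto simp: eventually_at_filter q)
  qed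
  \<comment> \<open>For |\<epsilon>| < 1 the argument of the root is at most \<open>norm x\<close>,
    so the majorant is summable and independent of \<epsilon>.\<close>
  have bound: "norm ((coord (q \<epsilon>) k)\<^sup>2) \<le> M\<^sup>2 * (coord x k)\<^sup>2"
    if \<epsilon>: "\<epsilon> \<noteq> 0" "\<bar>\<epsilon>\<bar> < 1" for \<epsilon> k
  proof -
    have "\<bar>\<epsilon> * coord x k\<bar> \<le> 1 * norm x"
      unfolding abs_mult using \<epsilon> by (intro mult_mono abs_coord_le_norm) auto
    then have "root (Suc k) \<bar>\<epsilon> * coord x k\<bar> \<le> max 1 (norm x)"
      using root_abs_le_max_1[of "Suc k" "\<epsilon> * coord x k"] by linarith
    then have "\<bar>coord (q \<epsilon>) k\<bar> \<le> M * \<bar>coord x k\<bar>"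
      by (simp add: q[OF \<epsilon>(1)] M_def abs_mult[of _ "coord x k"] mult_right_mono)
    then have "\<bar>coord (q \<epsilon>) k\<bar>\<^sup>2 \<le> (M * \<bar>coord x k\<bar>)\<^sup>2"
      by (rule power_mono) simp
    then show ?thesis
      by (simp add: power_mult_distrib)
  qed
  have ev: "\<forall>\<^sub>F \<epsilon> in at (0::real). \<epsilon> \<noteq> 0 \<and> \<bar>\<epsilon>\<bar> < 1"
    unfolding eventually_at by (intro exI[of _ 1]) (simp add: dist_norm)
  \<comment> \<open>Tannery's theorem, the dominated convergence theorem for series, exchanges limit
    and sum.\<close>
  have "((\<lambda>\<epsilon>. \<Sum>k. (coord (q \<epsilon>) k)\<^sup>2) \<longlongrightarrow> (\<Sum>k. 0)) (at 0)"
  proof (rule tannerys_theorem[of "\<lambda>k \<epsilon>. (coord (q \<epsilon>) k)\<^sup>2" _ _ "\<lambda>k. M\<^sup>2 * (coord x k)\<^sup>2", THEN conjunct2, THEN conjunct2])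
    show "\<forall>\<^sub>F (k, \<epsilon>) in at_top \<times>\<^sub>F at 0. norm ((coord (q \<epsilon>) k)\<^sup>2) \<le> M\<^sup>2 * (coord x k)\<^sup>2"
      using eventually_prodI[OF always_eventually[of "\<lambda>_. True"] ev]
      by (rule eventually_mono) (use bound in auto)
  qed (simp_all only: lim summable_mult summable_coord_square trivial_limit_at not_False_eq_True)
  then have "((\<lambda>\<epsilon>. (norm (q \<epsilon>))\<^sup>2) \<longlongrightarrow> 0) (at 0)"
    by (simp add: norm_ell2_sq)
  from tendsto_real_sqrt[OF this] have "((\<lambda>\<epsilon>. norm (q \<epsilon>)) \<longlongrightarrow> 0) (at 0)"
    by simp
  then show "((\<lambda>\<epsilon>. norm ((f_ell2 (\<epsilon> *\<^sub>R x) - f_ell2 0) /\<^sub>R \<epsilon> - 0)) \<longlongrightarrow> 0) (at 0)"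
    by (simp add: q_def)
qed

section \<open>Coordinate axes and failure of Frechet differentiability\<close>

definition unit_seq :: "nat \<Rightarrow> ell2"
  where "unit_seq k = of_seq (\<lambda>j. if j = k then 1 else 0)"

lemma coord_unit_seq: "coord (unit_seq k) j = (if j = k then 1 else 0)"
proof -
  have "(\<lambda>j. if j = k then 1 else 0) \<in> square_summable"
    unfolding square_summable_iff by (rule summable_finite[of "{k}"]) auto
  then show ?thesis
    by (simp add: unit_seq_def of_seq_inverse)
qed

lemma norm_unit_seq [simp]: "norm (unit_seq k) = 1"
proof -
  have "(norm (unit_seq k))\<^sup>2 = (\<Sum>j\<in>{k}. (coord (unit_seq k) j)\<^sup>2)"
    unfolding norm_ell2_sq by (rule suminf_finite) (auto simp: coord_unit_seq)
  then show ?thesis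
    by (simp add: coord_unit_seq power2_eq_1_iff) (use norm_ge_zero[of "unit_seq k"] in linarith)
qed

text \<open>Each axis is invariant, since \<open>f_ell2\<close> keeps zero coordinates zero. This
  reduces both the Frechet question and the differential equation to scalar problems.\<close>

lemma f_ell2_unit_seq:
  "f_ell2 (s *\<^sub>R unit_seq k) = (3 * root (Suc k) \<bar>s\<bar> * s) *\<^sub>R unit_seq k"
  by (rule ell2_eqI) (simp add: coord_f_ell2 coord_unit_seq)

text \<open>A derivative D would approximate \<open>f_ell2\<close> with relative error 1/4 on a ball
  of radius d. Along \<open>unit_seq k\<close> the difference quotient has norm 3 h^(1/n), n = k +
  1. Taking h small depending on k forces \<open>D (unit_seq k)\<close> to have norm at most 1/2,
  while h = d/2 and k large force norm above 5/4.\<close>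

lemma not_differentiable_f_ell2: "\<not> f_ell2 differentiable (at 0)"
proof
  assume "f_ell2 differentiable (at 0)"
  then obtain D where D: "(f_ell2 has_derivative D) (at 0)"
    by (auto simp: differentiable_def)
  then interpret D: bounded_linear D
    by (rule has_derivative_bounded_linear)
  obtain d where d: "d > 0"
    and close: "\<And>y. norm y < d \<Longrightarrow> norm (f_ell2 y - D y) \<le> 1 / 4 * norm y"
    using D unfolding has_derivative_at_alt
    by (metis diff_zero f_ell2_zero zero_less_divide_1_iff zero_less_numeral)
  have ray: "norm ((3 * root (Suc k) h) *\<^sub>R unit_seq k - D (unit_seq k)) \<le> 1 / 4"
    if h: "0 < h" "h < d" for h k
  proof -
    have "f_ell2 (h *\<^sub>R unit_seq k) - D (h *\<^sub>R unit_seq k)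
        = h *\<^sub>R ((3 * root (Suc k) h) *\<^sub>R unit_seq k - D (unit_seq k))"
      using h by (simp add: f_ell2_unit_seq D.scaleR scaleR_diff_right mult.commute)
    then show ?thesis
      using close[of "h *\<^sub>R unit_seq k"] h by simp
  qed
  have small: "norm (D (unit_seq k)) \<le> 1 / 2" for k
  proof -
    \<comment> \<open>The power makes 3 h^(1/n) at most 1/4; the minimum with d/2 keeps h inside the
      ball.\<close>
    define h where "h = min (d / 2) ((1 / 12) ^ Suc k)"
    have h: "0 < h" "h < d" "h \<le> (1 / 12) ^ Suc k"
      using d by (auto simp: h_def)
    have "root (Suc k) h \<le> root (Suc k) ((1 / 12) ^ Suc k)"
      using h(3) by (intro real_root_le_mono) auto
    then have "root (Suc k) h \<le> 1 / 12"
      by (subst (asm) real_root_power_cancel) auto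
    then have "norm ((3 * root (Suc k) h) *\<^sub>R unit_seq k) \<le> 1 / 4"
      using h(1) by simp
    then show ?thesis
      using ray[OF h(1,2), of k]
        norm_triangle_ineq3[of "(3 * root (Suc k) h) *\<^sub>R unit_seq k" "D (unit_seq k)"] by linarith
  qed
  \<comment> \<open>Now h = d/2 stays fixed and the degree grows.\<close>
  have "(\<lambda>n. root n (d / 2)) \<longlonglongrightarrow> 1"
    using d by (intro LIMSEQ_root_const) simp
  then have "\<forall>\<^sub>F n in sequentially. root n (d / 2) > 1 / 2"
    by (rule order_tendstoD) simp
  then obtain k where "root (Suc k) (d / 2) > 1 / 2"
    unfolding eventually_sequentially by (meson le_Suc_eq le_refl)
  then have "norm ((3 * root (Suc k) (d / 2)) *\<^sub>R unit_seq k) > 3 / 2"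
    by simp
  then show False
    using ray[of "d / 2" k] small[of k] d
      norm_triangle_ineq2[of "(3 * root (Suc k) (d / 2)) *\<^sub>R unit_seq k" "D (unit_seq k)"]
    by simp
qed

section \<open>Finite-time blow-up on the axes and instability\<close>

text \<open>On the \<open>k\<close>-th axis the system is the Bernoulli equation \<open>y' = - y + 3 y\<^bsup>1 + 1/n\<^esup>\<close> with
  \<open>n = k + 1\<close>, and \<open>w = y\<^bsup>-1/n\<^esup>\<close> solves the linear equation \<open>n w' = w - 3\<close>; \<open>w(0) = 2\<close> gives
  the following solution.\<close>

definition blowup :: "nat \<Rightarrow> real \<Rightarrow> ell2"
  where "blowup k t = (inverse (3 - exp (t / Suc k)) ^ Suc k) *\<^sub>R unit_seq k"

text \<open>Locates the blow-up time n ln 3, n = k + 1: the base inverted in \<open>blowup\<close>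
  is positive exactly before it.\<close>

lemma exp_less_3_iff: "exp (t / real (Suc k)) < 3 \<longleftrightarrow> t < Suc k * ln 3"
proof -
  have "exp (t / real (Suc k)) < 3 \<longleftrightarrow> t / real (Suc k) < ln 3"
    by (metis exp_less_cancel_iff exp_ln zero_less_numeral)
  then show ?thesis
    by (simp add: divide_less_eq mult.commute del: of_nat_Suc)
qed

lemma solution_on_blowup:
  "solution_on (\<lambda>x. - x + f_ell2 x) {0..<Suc k * ln 3} (blowup k)"
  unfolding solution_on_def
proof (intro conjI ballI)
  have pos: "0 < real (Suc k) * ln 3"
    by simp
  show "is_interval {0..<real (Suc k) * ln 3}"
    by (auto simp: is_interval_1)
  show "0 \<in> {0..<real (Suc k) * ln 3}"
    using pos by auto
  have "real (Suc k) * ln 3 / 2 \<in> {0..<real (Suc k) * ln 3}"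
    using pos by auto
  then show "{0..<real (Suc k) * ln 3} \<noteq> {0}"
    using pos by (metis half_gt_zero less_irrefl singletonD)
  fix t assume t: "t \<in> {0..<real (Suc k) * ln 3}"
  define w where "w = 3 - exp (t / Suc k)"
  have w: "w > 0"
    using t exp_less_3_iff[of t k] by (simp add: w_def)
  have "((\<lambda>t. inverse (3 - exp (t / Suc k)) ^ Suc k) has_real_derivative
      - (inverse w ^ Suc k) + 3 * inverse w * inverse w ^ Suc k) (at t within {0..<real (Suc k) * ln 3})"
  proof (rule DERIV_cong)
    \<comment> \<open>Since exp (t/n) = 3 - w, the derivative of 1/w is (3 - w) / (n w^2); the n
      from the power rule cancels the 1/n.\<close>
    have "((\<lambda>t. inverse (3 - exp (t / Suc k))) has_real_derivative
        (3 - w) / Suc k * inverse w ^ 2) (at t within {0..<real (Suc k) * ln 3})"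
      using w unfolding w_def
      by (auto intro!: derivative_eq_intros simp: power2_eq_square simp del: of_nat_Suc)
    then show "((\<lambda>t. inverse (3 - exp (t / Suc k)) ^ Suc k) has_real_derivative
        real (Suc k) * inverse w ^ k * ((3 - w) / Suc k * inverse w ^ 2))
        (at t within {0..<real (Suc k) * ln 3})"
      by (rule DERIV_cong[OF DERIV_power]) (simp add: w_def)
    show "real (Suc k) * inverse w ^ k * ((3 - w) / Suc k * inverse w ^ 2)
        = - (inverse w ^ Suc k) + 3 * inverse w * inverse w ^ Suc k"
      using w by (simp add: field_simps power2_eq_square del: of_nat_Suc)
  qed
  from has_vector_derivative_scaleR[OF this has_vector_derivative_const[of "unit_seq k"]]
  have "((\<lambda>t. (inverse (3 - exp (t / Suc k)) ^ Suc k) *\<^sub>R unit_seq k) has_vector_derivative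
      (- (inverse w ^ Suc k) + 3 * inverse w * inverse w ^ Suc k) *\<^sub>R unit_seq k)
      (at t within {0..<real (Suc k) * ln 3})"
    by (simp del: power_Suc of_nat_Suc)
  moreover have "- blowup k t + f_ell2 (blowup k t)
      = (- (inverse w ^ Suc k) + 3 * inverse w * inverse w ^ Suc k) *\<^sub>R unit_seq k"
  proof -
    \<comment> \<open>Hence \<open>f_ell2\<close> multiplies \<open>blowup k t\<close> by 3/w, which
      is the nonlinear term found above.\<close>
    have "root (Suc k) \<bar>inverse w ^ Suc k\<bar> = inverse w"
      using w real_root_power_cancel[of "Suc k" "inverse w"]
      by (metis abs_of_nonneg less_imp_le positive_imp_inverse_positive zero_le_power zero_less_Suc)
    then show ?thesis
      unfolding blowup_def w_def[symmetric] f_ell2_unit_seq by (simp add: scaleR_diff_left)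
  qed
  ultimately show "(blowup k has_vector_derivative - blowup k t + f_ell2 (blowup k t))
      (at t within {0..<real (Suc k) * ln 3})"
    by (simp add: blowup_def[abs_def])
qed auto

text \<open>A proper extension would contain the time T = n ln 3 and be continuous there. Multiplied
  by (3 - exp (t/n))^n, which vanishes at T, it would tend to 0; but before T this product is
  constantly \<open>unit_seq k\<close>, of norm 1.\<close>

lemma maximal_solution_on_blowup:
  "maximal_solution_on (\<lambda>x. - x + f_ell2 x) {0..<Suc k * ln 3} (blowup k)"
  unfolding maximal_solution_on_def
proof (intro conjI allI impI solution_on_blowup)
  define T where "T = Suc k * ln 3"
  have T: "T > 0"
    by (simp add: T_def)
  fix J y
  assume sol: "solution_on (\<lambda>x. - x + f_ell2 x) J y"
    and sub: "{0..<Suc k * ln 3} \<subseteq> J" and agree: "\<forall>t\<in>{0..<Suc k * ln 3}. y t = blowup k t"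
  have J: "is_interval J" "0 \<in> J" "J \<subseteq> {0..}"
    using sol by (auto simp: solution_on_def)
  show "J = {0..<Suc k * ln 3}"
  proof (rule ccontr)
    assume "J \<noteq> {0..<Suc k * ln 3}"
    then obtain s where "s \<in> J" "T \<le> s"
      using J(3) sub unfolding T_def by force
    then have "T \<in> J"
      using J T unfolding is_interval_1 by (meson less_imp_le)
    then have "continuous (at T within J) y"
      using sol unfolding solution_on_def by (blast intro: has_vector_derivative_continuous)
    then have "(y \<longlongrightarrow> y T) (at T within {0..<T})"
      unfolding continuous_within using sub T_def by (blast intro: tendsto_within_subset)
    then have "((\<lambda>t. ((3 - exp (t / Suc k)) ^ Suc k) *\<^sub>R y t) \<longlongrightarrow>
        ((3 - exp (T / Suc k)) ^ Suc k) *\<^sub>R y T) (at T within {0..<T})"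
      by (intro tendsto_intros) auto
    moreover have "((3 - exp (T / Suc k)) ^ Suc k) *\<^sub>R y T = 0"
      by (simp add: T_def del: of_nat_Suc)
    moreover have "((3 - exp (t / Suc k)) ^ Suc k) *\<^sub>R y t = unit_seq k" if "t \<in> {0..<T}" for t
    proof -
      have "3 - exp (t / Suc k) \<noteq> 0"
        using that exp_less_3_iff[of t k] by (simp add: T_def)
      then show ?thesis
        using that agree
        by (simp add: T_def blowup_def power_mult_distrib[symmetric] del: power_Suc of_nat_Suc)
    qed
    ultimately have "((\<lambda>t. unit_seq k) \<longlongrightarrow> 0) (at T within {0..<T})"
      by (smt (verit, best) Lim_cong_within)
    moreover have "at T within {0..<T} \<noteq> bot"
      using T by (simp add: trivial_limit_within islimpt_Ico)
    ultimately have "unit_seq k = 0"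
      by (simp add: tendsto_const_iff)
    then show False
      using norm_unit_seq[of k] by simp
  qed
qed

text \<open>Stability fails through global existence: maximal solutions with bounded interval start
  arbitrarily close to 0.\<close>

lemma unstable_equilibrium_f_ell2: "unstable_equilibrium_at_0 (\<lambda>x. - x + f_ell2 x)"
  unfolding unstable_equilibrium_at_0_def
proof (intro conjI notI)
  assume "lyapunov_stable_at_0 (\<lambda>x. - x + f_ell2 x)"
  then obtain \<delta> where \<delta>: "\<delta> > 0" and stable: "\<And>J x. maximal_solution_on (\<lambda>x. - x + f_ell2 x) J x \<Longrightarrow>
      norm (x 0) < \<delta> \<Longrightarrow> J = {0..}"
    unfolding lyapunov_stable_at_0_def by (meson zero_less_one)
  obtain k where k: "(1 / 2) ^ k < \<delta>"
    using \<delta> real_arch_pow_inv[of \<delta> "1 / 2"] by auto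
  \<comment> \<open>At t = 0 the inverted base is 3 - exp 0 = 2.\<close>
  have "norm (blowup k 0) = (1 / 2) ^ Suc k"
    by (simp add: blowup_def power_divide inverse_eq_divide)
  also have "\<dots> \<le> (1 / 2) ^ k"
    by simp
  finally have "norm (blowup k 0) < \<delta>"
    using k by simp
  then have eq: "{0..<Suc k * ln 3} = {0::real..}"
    by (rule stable[OF maximal_solution_on_blowup])
  have "Suc k * ln 3 \<in> {0..<Suc k * ln 3}"
    unfolding eq by simp
  then show False
    by simp
qed simp

theorem theorem3p2:
  shows "((\<forall>u\<in>square_summable. f_seq u \<in> square_summable) \<and> locally_lipschitz f_ell2) \<and>
    (gateaux_differentiable_at_0 f_ell2 \<and> \<not> f_ell2 differentiable (at 0)) \<and>
    unstable_equilibrium_at_0 (\<lambda>x. - x + f_ell2 x)"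
  \<comment> \<open>By \<open>of_seq_inverse\<close> every square-summable u is
    \<open>coord (of_seq u)\<close>, which carries the first claim over to sequences.\<close>
  using f_seq_coord_square_summable of_seq_inverse locally_lipschitz_f_ell2
    gateaux_differentiable_f_ell2 not_differentiable_f_ell2 unstable_equilibrium_f_ell2
  by metis

end
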